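(* For all integers $k\ge 1$ and $N_1,N_2,\ldots,N_k\ge 2$, with $\mathbf N=(N_1,\ldots,N_k)$, all Taylor coefficients of $\mathbf q_{\mathbf N}(z)$ at $0$ are positive, except the constant coefficient.
   Context: For an integer $N\ge 2$ let $r_1,\ldots,r_{\varphi(N)}$ be the integers in $\{1,\ldots,N\}$ coprime to $N$ ($\varphi$ is Euler's totient), and put $C_N:=N^{\varphi(N)}\prod_{p\mid N}p^{\varphi(N)/(p-1)}$ (product over primes $p$ dividing $N$). With $(\alpha)_m=\alpha(\alpha+1)\cdots(\alpha+m-1)$, $(\alpha)_0=1$, and $H(x,m)=\sum_{n=0}^{m-1}\frac1{x+n}$, define for $m\ge0$ $$\mathbf B_N(m)=C_N^m\prod_{j=1}^{\varphi(N)}\frac{(r_j/N)_m}{m!},\qquad \mathbf H_N(m)=\sum_{j=1}^{\varphi(N)}H(r_j/N,m)-\varphi(N)H(1,m).$$ For $\mathbf N=(N_1,\ldots,N_k)$ put $\mathbf B_{\mathbf N}(m)=\prod_{j=1}^k\mathbf B_{N_j}(m)$, $\mathbf H_{\mathbf N}(m)=\sum_{j=1}^k\mathbf H_{N_j}(m)$, and $$\mathbf F_{\mathbf N}(z)=\sum_{m\ge0}\mathbf B_{\mathbf N}(m)z^m,\qquad \mathbf G_{\mathbf N}(z)=\sum_{m\ge1}\mathbf H_{\mathbf N}(m)\mathbf B_{\mathbf N}(m)z^m.$$ The canonical coordinate is $\mathbf q_{\mathbf N}(z)=z\exp\big(\mathbf G_{\mathbf N}(z)/\mathbf F_{\mathbf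 N}(z)\big)$, a power series in $z$ with zero constant term. *)

theory Defs
  imports
    "HOL-Number_Theory.Totient"
    "HOL-Computational_Algebra.Formal_Power_Series"
begin

unbundle fps_syntax

(* C_N is an integer: each exponent totient N div (p - 1) is an exact quotient,
   see prime_minus_one_dvd_totient. *)
definition C_const :: "nat \<Rightarrow> nat" where
  "C_const N = N ^ totient N * (\<Prod>p\<in>prime_factors N. p ^ (totient N div (p - 1)))"

lemma prime_minus_one_dvd_totient:
  assumes "p \<in> prime_factors N"
  shows "p - 1 dvd totient N"
proof -
  from assms have "prime p" "p dvd N"
    by (auto simp: in_prime_factors_iff)
  then show ?thesis
    using totient_dvd[of p N] totient_prime[of p] by simp
qed

definition H_sum :: "real \<Rightarrow> nat \<Rightarrow> real" where
  "H_sum x m = (\<Sum>n<m. 1 / (x + real n))"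

(* totatives N is the set {r_1, ..., r_phi(N)}, and pochhammer a m is (a)_m. *)

definition B_single :: "nat \<Rightarrow> nat \<Rightarrow> real" where
  "B_single N m = real (C_const N) ^ m * (\<Prod>r\<in>totatives N. pochhammer (real r / real N) m / fact m)"

definition H_single :: "nat \<Rightarrow> nat \<Rightarrow> real" where
  "H_single N m = (\<Sum>r\<in>totatives N. H_sum (real r / real N) m) - real (totient N) * H_sum 1 m"

(* The tuple (N_1, ..., N_k) is represented by a list of length k. *)

definition B_tuple :: "nat list \<Rightarrow> nat \<Rightarrow> real" where
  "B_tuple Ns m = (\<Prod>N\<leftarrow>Ns. B_single N m)"

definition H_tuple :: "nat list \<Rightarrow> nat \<Rightarrow> real" where
  "H_tuple Ns m = (\<Sum>N\<leftarrow>Ns. H_single N m)"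

definition F_series :: "nat list \<Rightarrow> real fps" where
  "F_series Ns = Abs_fps (\<lambda>m. B_tuple Ns m)"

definition G_series :: "nat list \<Rightarrow> real fps" where
  "G_series Ns = Abs_fps (\<lambda>m. if m \<ge> 1 then H_tuple Ns m * B_tuple Ns m else 0)"

(* fps_compose is meaningful only for an inner series with zero constant term;
   this holds for G_series Ns / F_series Ns by the lemmas below. *)
definition canonical_q :: "nat list \<Rightarrow> real fps" where
  "canonical_q Ns = fps_X * fps_compose (fps_exp 1) (G_series Ns / F_series Ns)"

lemma F_nth_0: "F_series Ns $ 0 = 1"
  by (induction Ns) (simp_all add: F_series_def B_tuple_def B_single_def)

lemma G_div_F_nth_0: "(G_series Ns / F_series Ns) $ 0 = 0"
  by (simp add: fps_divide_unit F_nth_0 G_series_def)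

end

theory Submission
  imports Defs
begin

text \<open>
  Let \<open>B m\<close> and \<open>H m\<close> stand for \<open>B_tuple Ns m\<close> and \<open>H_tuple Ns m\<close>, so that
  \<open>F = \<Sum>m. B m * z ^ m\<close> and \<open>G = \<Sum>m. H m * B m * z ^ m\<close>.  Every totative \<open>r\<close> of
  some \<open>N \<ge> 2\<close> satisfies \<open>0 < r < N\<close>, and this has two consequences.  The ratio
  \<open>B (m + 1) / B m\<close> is a positive constant times a product of factors
  \<open>(r/N + m) / (1 + m)\<close>, which are positive and increase with \<open>m\<close>, so \<open>B\<close> is log-convex; and
  each summand \<open>1 / (r/N + m) - 1 / (1 + m)\<close> of \<open>H (m + 1) - H m\<close> is positive, so \<open>H\<close> is
  strictly increasing.

  By a theorem of Kaluza (\<open>inverse_nth_nonpos_of_log_convex\<close>), log-convexity of \<open>B\<close> makes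
  every nonconstant coefficient \<open>a i\<close> of \<open>1/F\<close> nonpositive.  Since \<open>F * (1/F) = 1\<close>, the
  sum \<open>\<Sum>i\<le>m. a i * B (m - i)\<close> vanishes for \<open>m \<ge> 1\<close>, and subtracting \<open>H m\<close> times it
  writes the \<open>m\<close>-th coefficient of \<open>G/F\<close> as \<open>\<Sum>i\<le>m. a i * B (m - i) * (H (m - i) - H m)\<close>.
  Here the term for \<open>i = 0\<close> is zero, each other term is a product of two nonpositive
  numbers and a positive one, and the term for \<open>i = 1\<close> is positive because
  \<open>a 1 = - B 1 < 0\<close>.  Hence \<open>G/F\<close> has positive nonconstant coefficients
  (\<open>weighted_quotient_nth_pos\<close>).  The exponential preserves this, because the exponential
  series has positive coefficients (\<open>fps_exp_compose_nth_pos\<close>).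
\<close>

section \<open>Quotients of power series with log-convex denominator\<close>

lemma sum_inverse_nth_mult_nth:
  fixes b :: "'a::field fps"
  assumes "b $ 0 \<noteq> 0" and "n \<ge> 1"
  shows "(\<Sum>i=0..n. inverse b $ i * b $ (n - i)) = 0"
  using assms by (simp add: inverse_mult_eq_1 flip: fps_mult_nth)

lemma inverse_nth_1_neg:
  fixes b :: "real fps"
  assumes "b $ 0 > 0" and "b $ 1 > 0"
  shows "inverse b $ 1 < 0"
proof -
  have "inverse b $ 0 * b $ 1 + inverse b $ 1 * b $ 0 = 0"
    using sum_inverse_nth_mult_nth[of b 1] assms by simp
  moreover have "inverse b $ 0 * b $ 1 > 0"
    using assms by simp
  ultimately have "inverse b $ 1 * b $ 0 < 0"
    by linarith
  then show ?thesis
    using assms by (simp add: mult_less_0_iff)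
qed

text \<open>
  Kaluza's theorem.  In the product \<open>b * inverse b = 1\<close> the coefficients of index \<open>m\<close> and
  \<open>m + 1\<close>, for \<open>m \<ge> 1\<close>, are both zero.  Eliminating the contribution of the constant term of \<open>inverse b\<close>
  between these two relations gives coefficient \<open>m + 1\<close> of \<open>inverse b\<close> in terms of those of index
  \<open>1, \<dots>, m\<close>, with factors whose sign is given by log-convexity.
\<close>

lemma inverse_nth_nonpos_of_log_convex:
  fixes b :: "real fps"
  assumes pos: "\<And>m. b $ m > 0"
    and log_convex: "incseq (\<lambda>m. b $ Suc m / b $ m)"
    and "n \<ge> 1"
  shows "inverse b $ n \<le> 0"
  using \<open>n \<ge> 1\<close>
proof (induction n rule: less_induct)
  case (less n)
  define a where "a = inverse b"
  have conv: "(\<Sum>i=0..j. a $ i * b $ (j - i)) = 0" if "j \<ge> 1" for j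
    unfolding a_def using pos[of 0] that by (intro sum_inverse_nth_mult_nth) auto
  show ?case
  proof (cases "n = 1")
    case True
    then show ?thesis
      using inverse_nth_1_neg[OF pos pos] by (simp add: less_imp_le)
  next
    case False
    with less.prems obtain m where n: "n = Suc m" and "m \<ge> 1"
      by (cases n) auto
    \<comment> \<open>The factor of \<open>a $ i\<close> in \<open>b $ m\<close> times relation \<open>m + 1\<close> minus \<open>b $ (m + 1)\<close> times
        relation \<open>m\<close>; it vanishes for \<open>i = 0\<close>.\<close>
    let ?d = "\<lambda>i. b $ m * b $ (Suc m - i) - b $ Suc m * b $ (m - i)"
    have "0 \<le> (\<Sum>i=0..m. a $ i * ?d i)"
    proof (rule sum_nonneg)
      fix i assume i: "i \<in> {0..m}"
      show "0 \<le> a $ i * ?d i"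
      proof (cases "i = 0")
        case False
        then have "a $ i \<le> 0"
          using less.IH[of i] i n by (simp add: a_def)
        moreover have "b $ Suc (m - i) / b $ (m - i) \<le> b $ Suc m / b $ m"
          using incseqD[OF log_convex, of "m - i" m] by simp
        then have "?d i \<le> 0"
          using pos[of m] pos[of "m - i"] i by (simp add: field_simps Suc_diff_le)
        ultimately show ?thesis
          by (rule mult_nonpos_nonpos)
      qed simp
    qed
    also have "\<dots> = b $ m * (\<Sum>i=0..m. a $ i * b $ (Suc m - i))
                    - b $ Suc m * (\<Sum>i=0..m. a $ i * b $ (m - i))"
      by (simp add: sum_distrib_left sum_subtractf algebra_simps)
    also have "\<dots> = - (b $ m * (a $ Suc m * b $ 0))"
      using conv[of "Suc m"] conv[of m] \<open>m \<ge> 1\<close>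
      by (simp add: eq_neg_iff_add_eq_0 flip: distrib_left)
    finally have "b $ m * b $ 0 * a $ Suc m \<le> 0"
      by (simp add: algebra_simps)
    then show ?thesis
      using mult_le_cancel_left_pos[of "b $ m * b $ 0" "a $ n" 0] pos[of m] pos[of 0] n
      by (simp add: a_def)
  qed
qed

text \<open>
  Multiplying the coefficients of \<open>b\<close> by a constant yields a quotient with no nonconstant
  coefficients.  So for the \<open>n\<close>-th coefficient only the differences \<open>h (n - i) - h n\<close>
  matter, and their sign matches that of the coefficients of \<open>inverse b\<close>.
\<close>

lemma weighted_quotient_nth_pos:
  fixes b :: "real fps" and h :: "nat \<Rightarrow> real"
  assumes pos: "\<And>m. b $ m > 0"
    and log_convex: "incseq (\<lambda>m. b $ Suc m / b $ m)"
    and h: "strict_mono h"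
    and "n \<ge> 1"
  shows "(Abs_fps (\<lambda>m. h m * b $ m) / b) $ n > 0"
proof -
  define a where "a = inverse b"
  have b0: "b $ 0 \<noteq> 0"
    using pos[of 0] by simp
  have a_nonpos: "a $ i \<le> 0" if "i \<ge> 1" for i
    unfolding a_def using pos log_convex that by (rule inverse_nth_nonpos_of_log_convex)
  let ?t = "\<lambda>i. a $ i * b $ (n - i) * (h (n - i) - h n)"
  have "(Abs_fps (\<lambda>m. h m * b $ m) / b) $ n = (\<Sum>i=0..n. a $ i * (h (n - i) * b $ (n - i)))"
    using b0 by (simp add: fps_divide_unit a_def fps_mult_nth mult.commute
                      flip: fps_mult_nth[of "inverse b"])
  also have "\<dots> = (\<Sum>i=0..n. ?t i) + h n * (\<Sum>i=0..n. a $ i * b $ (n - i))"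
    by (simp add: sum_distrib_left sum.distrib[symmetric] algebra_simps)
  also have "\<dots> = (\<Sum>i=0..n. ?t i)"
    using sum_inverse_nth_mult_nth[OF b0 \<open>n \<ge> 1\<close>] by (simp add: a_def)
  also have "\<dots> > 0"
  proof (rule sum_pos2[of _ 1])
    have "h (n - 1) < h n"
      using h \<open>n \<ge> 1\<close> by (simp add: strict_mono_less)
    then show "0 < ?t 1"
      using inverse_nth_1_neg[OF pos pos] pos[of "n - 1"]
      by (intro mult_neg_neg) (auto simp: a_def mult_less_0_iff)
    show "0 \<le> ?t i" if "i \<in> {0..n}" for i
    proof (cases "i = 0")
      case False
      have "h (n - i) \<le> h n"
        using h by (simp add: strict_mono_less_eq)
      moreover have "a $ i * b $ (n - i) \<le> 0"
        using a_nonpos[of i] False pos[of "n - i"] by (simp add: mult_le_0_iff less_imp_le)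
      ultimately show ?thesis
        by (intro mult_nonpos_nonpos) auto
    qed simp
  qed (use \<open>n \<ge> 1\<close> in auto)
  finally show ?thesis .
qed

section \<open>The exponential of a power series with positive coefficients\<close>

lemma fps_power_nth_nonneg:
  fixes c :: "real fps"
  assumes "\<And>n. c $ n \<ge> 0"
  shows "(c ^ i) $ n \<ge> 0"
proof (induction i arbitrary: n)
  case (Suc i)
  then show ?case
    using assms by (auto simp: fps_mult_nth intro!: sum_nonneg)
qed simp

lemma fps_exp_compose_nth_pos:
  fixes c :: "real fps"
  assumes c0: "c $ 0 = 0" and pos: "\<And>n. n \<ge> 1 \<Longrightarrow> c $ n > 0"
  shows "(fps_exp 1 oo c) $ n > 0"
proof (cases "n = 0")
  case False
  have "c $ m \<ge> 0" for m
    using c0 pos[of m] by (cases "m = 0") (auto simp: less_imp_le)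
  then have "(c ^ i) $ n \<ge> 0" for i
    by (rule fps_power_nth_nonneg)
  \<comment> \<open>Among the nonnegative terms \<open>c ^ i / fact i\<close>, the linear one is positive at \<open>n\<close>.\<close>
  then show ?thesis
    unfolding fps_compose_nth using False pos[of n]
    by (intro sum_pos2[of _ 1]) auto
qed simp

section \<open>The coefficients of the hypergeometric series\<close>

lemma totative_ratio:
  assumes "r \<in> totatives N" and "N \<ge> 2"
  shows "0 < real r / real N" and "real r / real N < 1"
  using assms totatives_less[of r N] by (auto simp: in_totatives_iff)

lemma B_single_pos:
  assumes "N \<ge> 2"
  shows "B_single N m > 0"
proof -
  have "C_const N > 0"
    using assms by (auto simp: C_const_def in_prime_factors_iff intro!: prod_pos prime_gt_0_nat)
  then show ?thesis
    unfolding B_single_def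
    by (intro mult_pos_pos prod_pos divide_pos_pos pochhammer_pos totative_ratio(1)[OF _ assms]) auto
qed

lemma B_single_ratio:
  assumes "N \<ge> 2"
  shows "B_single N (Suc m) / B_single N m
         = real (C_const N) * (\<Prod>r\<in>totatives N. (real r / real N + real m) / (1 + real m))"
proof -
  have "B_single N (Suc m)
        = real (C_const N) * (\<Prod>r\<in>totatives N. (real r / real N + real m) / (1 + real m)) * B_single N m"
    by (simp add: B_single_def pochhammer_Suc ac_simps times_divide_times_eq flip: prod.distrib)
  then show ?thesis
    using B_single_pos[OF assms, of m] by simp
qed

lemma B_single_log_convex:
  assumes "N \<ge> 2"
  shows "incseq (\<lambda>m. B_single N (Suc m) / B_single N m)"
  unfolding B_single_ratio[OF assms]
proof (intro incseq_SucI mult_left_mono prod_mono conjI)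
  fix m r assume r: "r \<in> totatives N"
  show "0 \<le> (real r / real N + real m) / (1 + real m)"
    by simp
  have "(x + real m) / (1 + real m) \<le> (x + real (Suc m)) / (1 + real (Suc m))" if "x < 1" for x
    using that by (simp add: field_simps)
  then show "(real r / real N + real m) / (1 + real m)
             \<le> (real r / real N + real (Suc m)) / (1 + real (Suc m))"
    using totative_ratio(2)[OF r assms] by blast
qed simp

lemma H_single_strict_mono:
  assumes "N \<ge> 2"
  shows "strict_mono (H_single N)"
proof (rule strict_mono_Suc_iff[THEN iffD2], rule allI)
  fix m
  have "H_single N (Suc m) - H_single N m
        = (\<Sum>r\<in>totatives N. 1 / (real r / real N + real m) - 1 / (1 + real m))"
    by (simp add: H_single_def H_sum_def sum.distrib sum_subtractf totient_def algebra_simps)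
  also have "\<dots> > 0"
  proof (rule sum_pos)
    show "totatives N \<noteq> {}"
      using assms totatives_eq_empty_iff[of N] by auto
    fix r assume "r \<in> totatives N"
    from totative_ratio[OF this assms]
    show "0 < 1 / (real r / real N + real m) - 1 / (1 + real m)"
      by (simp add: frac_less2)
  qed simp
  finally show "H_single N m < H_single N (Suc m)"
    by simp
qed

lemma B_tuple_pos:
  assumes "\<forall>N\<in>set Ns. N \<ge> 2"
  shows "B_tuple Ns m > 0"
  using assms by (induction Ns) (auto simp: B_tuple_def B_single_pos)

lemma B_tuple_log_convex:
  assumes "\<forall>N\<in>set Ns. N \<ge> 2"
  shows "incseq (\<lambda>m. B_tuple Ns (Suc m) / B_tuple Ns m)"
  using assms
proof (induction Ns)
  case Nil
  show ?case
    by (simp add: B_tuple_def)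
next
  case (Cons N Ns)
  have ratio: "B_tuple (N # Ns) (Suc m) / B_tuple (N # Ns) m
        = (B_single N (Suc m) / B_single N m) * (B_tuple Ns (Suc m) / B_tuple Ns m)" for m
    by (simp add: B_tuple_def)
  have "0 \<le> B_single N m" "0 \<le> B_tuple Ns m" for m
    using Cons.prems B_single_pos[of N] B_tuple_pos[of Ns] by (auto intro: less_imp_le)
  then show ?case
    unfolding ratio using B_single_log_convex[of N] Cons
    by (intro incseq_SucI mult_mono) (auto intro: incseq_SucD)
qed

lemma H_tuple_strict_mono:
  assumes "Ns \<noteq> []" and "\<forall>N\<in>set Ns. N \<ge> 2"
  shows "strict_mono (H_tuple Ns)"
  using assms
proof (induction Ns rule: list_nonempty_induct)
  case (single N)
  then show ?case
    by (simp add: H_tuple_def H_single_strict_mono)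
next
  case (cons N Ns)
  then have "strict_mono (\<lambda>m. H_single N m + H_tuple Ns m)"
    using H_single_strict_mono[of N] by (auto simp: strict_mono_def intro: add_strict_mono)
  then show ?case
    by (simp add: H_tuple_def)
qed

lemma H_tuple_0: "H_tuple Ns 0 = 0"
  by (induction Ns) (auto simp: H_tuple_def H_single_def H_sum_def)

section \<open>Positivity of the canonical coordinate\<close>

theorem theorem1p1:
  fixes k :: nat and Ns :: "nat list"
  assumes "k \<ge> 1" and "length Ns = k" and "\<forall>N\<in>set Ns. N \<ge> 2"
  shows "\<forall>n\<ge>1. canonical_q Ns $ n > 0"
proof (intro allI impI)
  fix n :: nat assume "n \<ge> 1"
  have "Ns \<noteq> []"
    using assms by auto
  have G: "G_series Ns = Abs_fps (\<lambda>m. H_tuple Ns m * F_series Ns $ m)"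
    by (rule fps_ext) (auto simp: G_series_def F_series_def H_tuple_0 not_le)
  have "(G_series Ns / F_series Ns) $ m > 0" if "m \<ge> 1" for m
    unfolding G
  proof (rule weighted_quotient_nth_pos[OF _ _ _ that])
    show "F_series Ns $ i > 0" for i
      using B_tuple_pos[OF assms(3)] by (simp add: F_series_def)
    show "incseq (\<lambda>i. F_series Ns $ Suc i / F_series Ns $ i)"
      using B_tuple_log_convex[OF assms(3)] by (simp add: F_series_def)
    show "strict_mono (H_tuple Ns)"
      using \<open>Ns \<noteq> []\<close> assms(3) by (rule H_tuple_strict_mono)
  qed
  \<comment> \<open>The factor \<open>z\<close> of the canonical coordinate shifts the index by one.\<close>
  then have "(fps_exp 1 oo (G_series Ns / F_series Ns)) $ (n - 1) > 0"
    by (intro fps_exp_compose_nth_pos G_div_F_nth_0)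
  then show "canonical_q Ns $ n > 0"
    using \<open>n \<ge> 1\<close> by (simp add: canonical_q_def)
qed

end
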